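(* Let $T,U\in GL(H)$ and let $\{\Lambda_i\in L(H,H_i)\}_{i\in I}$ be a family of bounded operators. Suppose that, for each $i\in I$, $\{e_{ij}:j\in J_i\}$ is an orthonormal basis for $H_i$, and put $u_{ij}=\Lambda_i^*e_{ij}$. Then $\{\Lambda_i\}_{i\in I}$ is a $(T,U)$-controlled g-frame for $H$ if and only if $\{T^*u_{ij}:i\in I,\,j\in J_i\}$ is a $U^*(T^* )^{-1}$-controlled frame for $H$.
   Context: $H$ is a separable Hilbert space, $I\subset\mathbb Z$, and $\{H_i\}_{i\in I}$ is a family of separable Hilbert spaces. $L(H,H_i)$ is the set of bounded linear operators $H\to H_i$; $GL(H)$ is the set of bounded linear operators on $H$ with bounded inverse. A family $\{\Lambda_i\in L(H,H_i)\}_{i\in I}$ is a g-Bessel sequence if there is $D<\infty$ with $\sum_{i\in I}\|\Lambda_if\|^2\le D\|f\|^2$ for all $f\in H$. For $T,U\in GL(H)$ it is a $(T,U)$-controlled g-frame for $H$ if it is a g-Bessel sequence and there exist $0<A\le B<\infty$ with $A\|f\|^2\le\sum_{i\in I}\langle\Lambda_iTf,\Lambda_iUf\rangle\le B\|f\|^2$ for all $f\in H$. For $\Omega\in GL(H)$, a family of vectors $\{f_{ij}:i\in I,\,j\in J_i\}$ in $H$ is an $\Omega$-controlled frame for $H$ if there exist $0<A\le B<\infty$ such that $$A\|f\|^2\le\sum_{i\in I}\sum_{j\in J_i}\langle f,f_{ij}\rangle\langle\Omega f_{ij},f\rangle\le B\|f\|^2\qquad\text{for all } f\in H.$$ *)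

theory Defs
  imports "HOL-Analysis.Analysis" "HOL-Algebra.Module"
begin

section \<open>Complex Hilbert spaces with explicit carriers\<close>

text \<open>
  A family of Hilbert spaces indexed by a set cannot be a family of types, so Hilbert spaces are
  structures in the style of HOL-Algebra: modules over the ring of complex numbers together with an
  inner product, linear in the first argument. The ring multiplication and unit that the record
  \<^term>\<open>module\<close> inherits play no role.
\<close>

definition complex_ring :: "complex ring" where
  "complex_ring = \<lparr>carrier = UNIV, mult = (*), one = 1, zero = 0, add = (+)\<rparr>"

lemma cring_complex_ring: "cring complex_ring"
proof (rule cringI)
  show "abelian_group complex_ring"
    by (rule abelian_groupI) (auto simp: complex_ring_def intro: exI[of _ "- x" for x])
  show "Group.comm_monoid complex_ring"
    by (rule comm_monoidI) (auto simp: complex_ring_def)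
qed (auto simp: complex_ring_def algebra_simps)

record 'v inner_module = "(complex, 'v) module" +
  ip :: "'v \<Rightarrow> 'v \<Rightarrow> complex"

locale complex_inner_space = module complex_ring V
  for V :: "'v inner_module" (structure) +
  assumes ip_add_left:
      "\<lbrakk>x \<in> carrier V; y \<in> carrier V; z \<in> carrier V\<rbrakk> \<Longrightarrow> ip V (x \<oplus> y) z = ip V x z + ip V y z"
    and ip_smult_left:
      "\<lbrakk>x \<in> carrier V; y \<in> carrier V\<rbrakk> \<Longrightarrow> ip V (c \<odot> x) y = c * ip V x y"
    and ip_commute:
      "\<lbrakk>x \<in> carrier V; y \<in> carrier V\<rbrakk> \<Longrightarrow> ip V y x = cnj (ip V x y)"
    and ip_nonneg: "x \<in> carrier V \<Longrightarrow> 0 \<le> Re (ip V x x)"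
    and ip_definite: "\<lbrakk>x \<in> carrier V; ip V x x = 0\<rbrakk> \<Longrightarrow> x = \<zero>"

definition ip_norm :: "'v inner_module \<Rightarrow> 'v \<Rightarrow> real" where
  "ip_norm V x = sqrt (Re (ip V x x))"

text \<open>The value outside the carrier is irrelevant, but \<^locale>\<open>Metric_space\<close> wants a distance that is
  total, nonnegative and symmetric.\<close>

definition ip_dist :: "'v inner_module \<Rightarrow> 'v \<Rightarrow> 'v \<Rightarrow> real" where
  "ip_dist V x y =
     (if x \<in> carrier V \<and> y \<in> carrier V then ip_norm V (x \<ominus>\<^bsub>V\<^esub> y) else 0)"

context complex_inner_space
begin

lemma smult_closed_complex: "x \<in> carrier V \<Longrightarrow> c \<odot> x \<in> carrier V"
  by (rule smult_closed) (simp_all add: complex_ring_def)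

lemma ip_add_right:
  "\<lbrakk>x \<in> carrier V; y \<in> carrier V; z \<in> carrier V\<rbrakk> \<Longrightarrow> ip V z (x \<oplus> y) = ip V z x + ip V z y"
  using ip_add_left[of x y z] ip_commute[of "x \<oplus> y" z] ip_commute[of x z] ip_commute[of y z]
  by simp

lemma ip_smult_right:
  "\<lbrakk>x \<in> carrier V; y \<in> carrier V\<rbrakk> \<Longrightarrow> ip V y (c \<odot> x) = cnj c * ip V y x"
  using ip_smult_left[of x y c] ip_commute[of "c \<odot> x" y] ip_commute[of x y]
  by (simp add: smult_closed_complex)

lemma ip_zero_left: "x \<in> carrier V \<Longrightarrow> ip V \<zero> x = 0"
  using ip_add_left[of "\<zero>" "\<zero>" x] by simp

lemma ip_minus_left:
  assumes "x \<in> carrier V" "z \<in> carrier V" shows "ip V (\<ominus> x) z = - ip V x z"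
proof -
  have "ip V x z + ip V (\<ominus> x) z = ip V (x \<oplus> \<ominus> x) z"
    using assms by (simp add: ip_add_left)
  also have "\<dots> = 0" using assms by (simp add: ip_zero_left M.r_neg)
  finally show ?thesis by (simp add: add_eq_0_iff)
qed

lemma ip_minus_right:
  assumes "x \<in> carrier V" "z \<in> carrier V" shows "ip V z (\<ominus> x) = - ip V z x"
  using assms ip_minus_left[of x z] ip_commute[of "\<ominus> x" z] ip_commute[of x z] by simp

lemma ip_self: "x \<in> carrier V \<Longrightarrow> ip V x x = of_real ((ip_norm V x)\<^sup>2)"
  using ip_commute[of x x] ip_nonneg[of x]
  by (simp add: ip_norm_def complex_eq_iff)

lemma ip_norm_nonneg: "x \<in> carrier V \<Longrightarrow> 0 \<le> ip_norm V x"
  by (simp add: ip_norm_def ip_nonneg)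

lemma Cauchy_Schwarz:
  assumes x: "x \<in> carrier V" and y: "y \<in> carrier V"
  shows "cmod (ip V x y) \<le> ip_norm V x * ip_norm V y"
proof (cases "ip V y y = 0")
  case True
  then have "y = \<zero>" using ip_definite y by blast
  then have "ip V x y = 0" using ip_zero_left[OF x] ip_commute[of y x] x y by simp
  then show ?thesis using x y by (simp add: ip_norm_nonneg)
next
  case False
  define a where "a = ip V x y"
  define n where "n = (ip_norm V y)\<^sup>2"
  have yy: "ip V y y = of_real n" using ip_self[OF y] by (simp add: n_def)
  have n: "n > 0" using False yy by (simp add: n_def)
  define c where "c = - (a / of_real n)"
  have yx: "ip V y x = cnj a" using ip_commute[OF x y] by (simp add: a_def)
  have cy: "c \<odot> y \<in> carrier V" using y by (rule smult_closed_complex)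
  have "ip V (x \<oplus> c \<odot> y) (x \<oplus> c \<odot> y) =
      ip V x x + cnj c * a + c * cnj a + c * cnj c * of_real n"
    using x y cy
    by (simp add: ip_add_left ip_add_right ip_smult_left ip_smult_right yx yy algebra_simps
        flip: a_def)
  also have "\<dots> = ip V x x - a * cnj a / of_real n"
    using n by (simp add: c_def field_simps)
  also have "\<dots> = of_real ((ip_norm V x)\<^sup>2 - (cmod a)\<^sup>2 / n)"
    using ip_self[OF x] complex_norm_square[of a] by simp
  finally have "0 \<le> (ip_norm V x)\<^sup>2 - (cmod a)\<^sup>2 / n"
    using ip_nonneg[of "x \<oplus> c \<odot> y"] x cy by simp
  then have "(cmod a)\<^sup>2 \<le> (ip_norm V x * ip_norm V y)\<^sup>2"
    using n by (simp add: field_simps n_def power_mult_distrib)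
  then show ?thesis
    using x y by (simp add: a_def abs_le_square_iff[symmetric] ip_norm_nonneg)
qed

lemma ip_norm_triangle:
  assumes x: "x \<in> carrier V" and y: "y \<in> carrier V"
  shows "ip_norm V (x \<oplus> y) \<le> ip_norm V x + ip_norm V y"
proof (rule power2_le_imp_le)
  have "of_real ((ip_norm V (x \<oplus> y))\<^sup>2) = ip V (x \<oplus> y) (x \<oplus> y)"
    using x y by (simp add: ip_self)
  also have "\<dots> = of_real ((ip_norm V x)\<^sup>2) + of_real ((ip_norm V y)\<^sup>2) + (ip V x y + cnj (ip V x y))"
    using x y ip_commute[OF x y]
    by (simp add: ip_add_left ip_add_right ip_self[OF x, symmetric] ip_self[OF y, symmetric]
        del: of_real_power)
  also have "\<dots> = of_real ((ip_norm V x)\<^sup>2 + (ip_norm V y)\<^sup>2 + 2 * Re (ip V x y))"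
    by (simp add: complex_add_cnj)
  finally have "(ip_norm V (x \<oplus> y))\<^sup>2 = (ip_norm V x)\<^sup>2 + (ip_norm V y)\<^sup>2 + 2 * Re (ip V x y)"
    unfolding of_real_eq_iff .
  then show "(ip_norm V (x \<oplus> y))\<^sup>2 \<le> (ip_norm V x + ip_norm V y)\<^sup>2"
    using Cauchy_Schwarz[OF x y] complex_Re_le_cmod[of "ip V x y"]
    by (simp add: power2_sum)
qed (simp add: x y ip_norm_nonneg)

sublocale Metric_space "carrier V" "ip_dist V"
proof
  fix x y
  show "0 \<le> ip_dist V x y" by (simp add: ip_dist_def ip_norm_nonneg)
  have "ip V (x \<ominus> y) (x \<ominus> y) = ip V (y \<ominus> x) (y \<ominus> x)" if "x \<in> carrier V" "y \<in> carrier V"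
    using that
    by (simp add: M.minus_eq ip_add_left ip_add_right ip_minus_left ip_minus_right)
  then show "ip_dist V x y = ip_dist V y x" by (auto simp: ip_dist_def ip_norm_def)
  assume xy: "x \<in> carrier V" "y \<in> carrier V"
  have "ip_norm V z = 0 \<longleftrightarrow> z = \<zero>" if "z \<in> carrier V" for z
    using that ip_self[of z] ip_definite[of z] ip_zero_left[of "\<zero>"] by (auto simp: ip_norm_def)
  moreover have "x \<ominus> y = \<zero> \<longleftrightarrow> x = y"
  proof
    assume "x \<ominus> y = \<zero>"
    then have "\<ominus> (\<ominus> y) = x"
      using xy by (intro M.minus_equality) (simp_all add: M.minus_eq)
    then show "x = y" using xy by simp
  qed (use xy in \<open>simp add: M.minus_eq M.r_neg\<close>)
  ultimately show "(ip_dist V x y = 0) = (x = y)"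
    using xy by (simp add: ip_dist_def)
next
  fix x y z
  assume xyz: "x \<in> carrier V" "y \<in> carrier V" "z \<in> carrier V"
  have "x \<ominus> z = (x \<ominus> y) \<oplus> (y \<ominus> z)"
    using xyz by (simp add: M.minus_eq M.a_assoc M.r_neg1)
  then show "ip_dist V x z \<le> ip_dist V x y + ip_dist V y z"
    using xyz ip_norm_triangle[of "x \<ominus> y" "y \<ominus> z"] by (simp add: ip_dist_def)
qed

end

locale separable_hilbert_space = complex_inner_space +
  assumes complete: "mcomplete"
    and separable: "separable_space mtopology"

definition orthonormal_basis :: "'v inner_module \<Rightarrow> 'j set \<Rightarrow> ('j \<Rightarrow> 'v) \<Rightarrow> bool" where
  "orthonormal_basis V J e \<longleftrightarrow>
     e \<in> J \<rightarrow> carrier V \<and>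
     (\<forall>j\<in>J. \<forall>k\<in>J. ip V (e j) (e k) = (if j = k then 1 else 0)) \<and>
     Metric_space.mtopology (carrier V) (ip_dist V) closure_of
       {\<Oplus>\<^bsub>V\<^esub>j\<in>F. c j \<odot>\<^bsub>V\<^esub> e j | F c. finite F \<and> F \<subseteq> J} = carrier V"


section \<open>Bounded operators\<close>

definition bounded_ops :: "'v inner_module \<Rightarrow> 'w inner_module \<Rightarrow> ('v \<Rightarrow> 'w) set" where
  "bounded_ops V W = {A. A \<in> carrier V \<rightarrow> carrier W \<and>
     (\<forall>x\<in>carrier V. \<forall>y\<in>carrier V. A (x \<oplus>\<^bsub>V\<^esub> y) = A x \<oplus>\<^bsub>W\<^esub> A y) \<and>
     (\<forall>c. \<forall>x\<in>carrier V. A (c \<odot>\<^bsub>V\<^esub> x) = c \<odot>\<^bsub>W\<^esub> A x) \<and>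
     (\<exists>C. \<forall>x\<in>carrier V. ip_norm W (A x) \<le> C * ip_norm V x)}"

definition op_inv :: "'v inner_module \<Rightarrow> ('v \<Rightarrow> 'v) \<Rightarrow> 'v \<Rightarrow> 'v" where
  "op_inv V A = inv_into (carrier V) A"

definition GL :: "'v inner_module \<Rightarrow> ('v \<Rightarrow> 'v) set" where
  "GL V = {A \<in> bounded_ops V V.
     bij_betw A (carrier V) (carrier V) \<and> op_inv V A \<in> bounded_ops V V}"

definition adj :: "'v inner_module \<Rightarrow> 'w inner_module \<Rightarrow> ('v \<Rightarrow> 'w) \<Rightarrow> 'w \<Rightarrow> 'v" where
  "adj V W A y = (THE x. x \<in> carrier V \<and> (\<forall>v\<in>carrier V. ip W (A v) y = ip V v x))"


section \<open>Controlled frames\<close>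

text \<open>
  All infinite sums are unconditional. The two-sided estimates contain the assertion that the sums
  converge and that the resulting complex number is a real number.
\<close>

definition g_bessel ::
  "'v inner_module \<Rightarrow> int set \<Rightarrow> (int \<Rightarrow> 'w inner_module) \<Rightarrow> (int \<Rightarrow> 'v \<Rightarrow> 'w) \<Rightarrow> bool" where
  "g_bessel H I K \<Lambda> \<longleftrightarrow>
     (\<forall>i\<in>I. \<Lambda> i \<in> bounded_ops H (K i)) \<and>
     (\<exists>D. \<forall>f\<in>carrier H.
        (\<lambda>i. (ip_norm (K i) (\<Lambda> i f))\<^sup>2) summable_on I \<and>
        (\<Sum>\<^sub>\<infinity>i\<in>I. (ip_norm (K i) (\<Lambda> i f))\<^sup>2) \<le> D * (ip_norm H f)\<^sup>2)"

definition controlled_g_frame ::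
  "'v inner_module \<Rightarrow> int set \<Rightarrow> (int \<Rightarrow> 'w inner_module) \<Rightarrow> ('v \<Rightarrow> 'v) \<Rightarrow> ('v \<Rightarrow> 'v) \<Rightarrow>
   (int \<Rightarrow> 'v \<Rightarrow> 'w) \<Rightarrow> bool" where
  "controlled_g_frame H I K T U \<Lambda> \<longleftrightarrow>
     T \<in> GL H \<and> U \<in> GL H \<and> g_bessel H I K \<Lambda> \<and>
     (\<exists>A B. 0 < A \<and> A \<le> B \<and>
        (\<forall>f\<in>carrier H. \<exists>s::real.
           ((\<lambda>i. ip (K i) (\<Lambda> i (T f)) (\<Lambda> i (U f))) has_sum complex_of_real s) I \<and>
           A * (ip_norm H f)\<^sup>2 \<le> s \<and> s \<le> B * (ip_norm H f)\<^sup>2))"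

definition controlled_frame ::
  "'v inner_module \<Rightarrow> int set \<Rightarrow> (int \<Rightarrow> 'j set) \<Rightarrow> ('v \<Rightarrow> 'v) \<Rightarrow> (int \<Rightarrow> 'j \<Rightarrow> 'v) \<Rightarrow> bool" where
  "controlled_frame H I J \<Omega> \<phi> \<longleftrightarrow>
     \<Omega> \<in> GL H \<and> (\<forall>i\<in>I. \<forall>j\<in>J i. \<phi> i j \<in> carrier H) \<and>
     (\<exists>A B. 0 < A \<and> A \<le> B \<and>
        (\<forall>f\<in>carrier H. \<exists>t. \<exists>s::real.
           (\<forall>i\<in>I. ((\<lambda>j. ip H f (\<phi> i j) * ip H (\<Omega> (\<phi> i j)) f) has_sum t i) (J i)) \<and>
           (t has_sum complex_of_real s) I \<and>
           A * (ip_norm H f)\<^sup>2 \<le> s \<and> s \<le> B * (ip_norm H f)\<^sup>2))"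

end

theory Submission
  imports Defs
begin

text \<open>
  Write \<open>\<phi> i j = T\<^sup>* u i j\<close> and \<open>\<Omega> = U\<^sup>* (T\<^sup>*)\<^sup>-\<^sup>1\<close>. Since \<open>u i j = \<Lambda> i\<^sup>* (e i j)\<close>, moving the adjoints across
  the inner product gives \<open>\<langle>f, \<phi> i j\<rangle> = \<langle>\<Lambda> i T f, e i j\<rangle>\<close>, and since \<open>\<Omega> (\<phi> i j) = U\<^sup>* u i j\<close> also
  \<open>\<langle>\<Omega> (\<phi> i j), f\<rangle> = \<langle>e i j, \<Lambda> i U f\<rangle>\<close>. By Parseval's identity in the space of index \<open>i\<close> (lemma
  \<open>parseval\<close>), the sum over \<open>j\<close> of the products is \<open>\<langle>\<Lambda> i T f, \<Lambda> i U f\<rangle>\<close>. Hence the two-sided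
  estimates that define the two kinds of frame are about the same series, term by term in \<open>i\<close>.

  What remains is that a controlled g-frame is required to be a g-Bessel sequence, whereas the
  notion of a controlled frame contains no such condition: it has to be derived from the
  estimates (lemma \<open>g_bessel_if_upper_bound\<close>). The series converges on the diagonal for every
  vector, so by polarization \<open>\<Sum>i. \<langle>\<Lambda> i T f, \<Lambda> i U g\<rangle>\<close> converges for all \<open>f\<close> and \<open>g\<close>. As \<open>T\<close> and \<open>U\<close>
  are invertible, one may take \<open>f = T\<^sup>-\<^sup>1 h\<close> and \<open>g = U\<^sup>-\<^sup>1 h\<close>, and the series becomes
  \<open>\<Sum>i. \<parallel>\<Lambda> i h\<parallel>\<^sup>2\<close>. The upper frame bound on the diagonal gives a bound by a multiple of \<open>\<parallel>h\<parallel>\<^sup>2\<close>.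

  The operator adjoints used here exist by the Riesz representation theorem (lemma
  \<open>riesz_representation\<close>), and passing to adjoints preserves invertibility (lemma \<open>GL_adj\<close>), so
  that \<open>\<Omega>\<close> is invertible.
\<close>

section \<open>Riesz representation\<close>

context complex_inner_space
begin

lemma norm_sq: "x \<in> carrier V \<Longrightarrow> (ip_norm V x)\<^sup>2 = Re (ip V x x)"
  by (simp add: ip_norm_def ip_nonneg)

lemma norm_sq_add:
  assumes "x \<in> carrier V" "y \<in> carrier V"
  shows "(ip_norm V (x \<oplus> y))\<^sup>2 = (ip_norm V x)\<^sup>2 + (ip_norm V y)\<^sup>2 + 2 * Re (ip V x y)"
  using assms ip_commute[of x y] by (simp add: norm_sq ip_add_left ip_add_right)

lemma norm_sq_smult:
  assumes "x \<in> carrier V"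
  shows "(ip_norm V (c \<odot> x))\<^sup>2 = (cmod c)\<^sup>2 * (ip_norm V x)\<^sup>2"
proof -
  have "ip V (c \<odot> x) (c \<odot> x) = of_real ((cmod c)\<^sup>2 * (ip_norm V x)\<^sup>2)"
    using assms ip_self[of x] complex_norm_square[of c]
    by (simp add: ip_smult_left ip_smult_right smult_closed_complex)
  then show ?thesis
    using assms by (simp add: norm_sq smult_closed_complex del: of_real_mult of_real_power)
qed

lemma norm_smult:
  assumes "x \<in> carrier V"
  shows "ip_norm V (c \<odot> x) = cmod c * ip_norm V x"
proof (rule power2_eq_imp_eq)
  show "(ip_norm V (c \<odot> x))\<^sup>2 = (cmod c * ip_norm V x)\<^sup>2"
    using norm_sq_smult[OF assms] by (simp add: power_mult_distrib)
qed (use assms in \<open>simp_all add: ip_norm_nonneg smult_closed_complex\<close>)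

lemma parallelogram:
  assumes "x \<in> carrier V" "y \<in> carrier V"
  shows "(ip_norm V (x \<ominus> y))\<^sup>2 = 2 * (ip_norm V x)\<^sup>2 + 2 * (ip_norm V y)\<^sup>2 - (ip_norm V (x \<oplus> y))\<^sup>2"
  using assms
  by (simp add: norm_sq M.minus_eq ip_add_left ip_add_right ip_minus_left ip_minus_right)

lemma ip_diff_left:
  assumes "x \<in> carrier V" "y \<in> carrier V" "z \<in> carrier V"
  shows "ip V (x \<ominus> y) z = ip V x z - ip V y z"
  using assms by (simp add: M.minus_eq ip_add_left ip_minus_left)

lemma ip_diff_right:
  assumes "x \<in> carrier V" "y \<in> carrier V" "z \<in> carrier V"
  shows "ip V z (x \<ominus> y) = ip V z x - ip V z y"
  using assms by (simp add: M.minus_eq ip_add_right ip_minus_right)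

lemma eq_if_ip_eq:
  assumes x: "x \<in> carrier V" and y: "y \<in> carrier V"
    and eq: "\<And>v. v \<in> carrier V \<Longrightarrow> ip V v x = ip V v y"
  shows "x = y"
proof -
  have "ip V (x \<ominus> y) (x \<ominus> y) = 0"
    using x y eq by (simp add: ip_diff_right)
  then have "ip_dist V x y = 0" using x y by (simp add: ip_dist_def ip_norm_def)
  then show ?thesis using x y by simp
qed

text \<open>
  The representing vector of \<open>\<phi>\<close> is the minimiser of the energy \<open>\<parallel>x\<parallel>\<^sup>2 / 2 - Re (\<phi> x)\<close>, which is
  bounded below because \<open>\<phi>\<close> is bounded. The parallelogram law makes every minimising sequence a
  Cauchy sequence, and near-minimality of its members forces the directional derivatives
  \<open>Re \<langle>v, x n\<rangle> - Re (\<phi> v)\<close> to tend to zero, so that the limit represents the real part of \<open>\<phi>\<close>.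
  Complex linearity then gives the imaginary part.
\<close>

lemma riesz_representation:
  assumes complete: "mcomplete"
    and add: "\<And>x y. \<lbrakk>x \<in> carrier V; y \<in> carrier V\<rbrakk> \<Longrightarrow> \<phi> (x \<oplus> y) = \<phi> x + \<phi> y"
    and smult: "\<And>c x. x \<in> carrier V \<Longrightarrow> \<phi> (c \<odot> x) = c * \<phi> x"
    and bound: "\<And>x. x \<in> carrier V \<Longrightarrow> cmod (\<phi> x) \<le> C * ip_norm V x"
  shows "\<exists>r\<in>carrier V. \<forall>v\<in>carrier V. \<phi> v = ip V v r"
proof -
  define E where "E x = (ip_norm V x)\<^sup>2 / 2 - Re (\<phi> x)" for x
  define m where "m = Inf (E ` carrier V)"
  have "- (C\<^sup>2 / 2) \<le> E x" if "x \<in> carrier V" for x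
  proof -
    have "Re (\<phi> x) \<le> C * ip_norm V x"
      using bound[OF that] complex_Re_le_cmod[of "\<phi> x"] by linarith
    moreover have "0 \<le> (ip_norm V x - C)\<^sup>2" by simp
    ultimately show ?thesis by (simp add: E_def power2_diff algebra_simps)
  qed
  then have bdd: "bdd_below (E ` carrier V)" by (intro bdd_belowI2)
  have m: "m \<le> E x" if "x \<in> carrier V" for x
    unfolding m_def using that bdd by (intro cInf_lower) auto
  have "\<exists>x\<in>carrier V. E x < m + 1 / real (Suc n)" for n
  proof -
    have "E ` carrier V \<noteq> {}" by auto
    from cInf_less_iff[OF this bdd, of "m + 1 / real (Suc n)"] show ?thesis
      by (auto simp: m_def)
  qed
  then obtain x where x: "\<And>n. x n \<in> carrier V" and xm: "\<And>n. E (x n) < m + 1 / real (Suc n)"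
    by metis
  have dist: "(ip_dist V (x k) (x l))\<^sup>2 < 4 / real (Suc k) + 4 / real (Suc l)" for k l
  proof -
    \<comment> \<open>The midpoint cannot have energy below the infimum.\<close>
    define h where "h = (1/2) \<odot> (x k \<oplus> x l)"
    have h: "h \<in> carrier V" using x by (simp add: h_def smult_closed_complex)
    have "Re (\<phi> h) = (Re (\<phi> (x k)) + Re (\<phi> (x l))) / 2"
    proof -
      have "2 * \<phi> h = \<phi> (x k) + \<phi> (x l)" using x by (simp add: h_def smult add)
      from arg_cong[OF this, of Re] show ?thesis by simp
    qed
    moreover have "(ip_norm V h)\<^sup>2 = (ip_norm V (x k \<oplus> x l))\<^sup>2 / 4"
      using x norm_sq_smult[of "x k \<oplus> x l" "1/2"] by (simp add: h_def power_divide norm_divide)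
    ultimately have "(ip_dist V (x k) (x l))\<^sup>2 = 4 * (E (x k) + E (x l) - 2 * E h)"
      using x by (simp add: ip_dist_def E_def parallelogram field_simps)
    then show ?thesis using m[OF h] xm[of k] xm[of l] by simp
  qed
  have "MCauchy x"
    unfolding MCauchy_def
  proof (intro conjI allI impI)
    show "range x \<subseteq> carrier V" using x by auto
    fix \<epsilon> :: real assume "\<epsilon> > 0"
    then have "\<epsilon>\<^sup>2 / 8 > 0" by simp
    from reals_Archimedean[OF this] obtain N where N: "inverse (real (Suc N)) < \<epsilon>\<^sup>2 / 8" by blast
    have "ip_dist V (x k) (x l) < \<epsilon>" if "N \<le> k" "N \<le> l" for k l
    proof -
      have "4 / real (Suc k) \<le> 4 / real (Suc N)" "4 / real (Suc l) \<le> 4 / real (Suc N)"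
        using that by (auto intro!: divide_left_mono)
      then have "(ip_dist V (x k) (x l))\<^sup>2 < \<epsilon>\<^sup>2"
        using dist[of k l] N by (simp add: inverse_eq_divide)
      then show ?thesis using \<open>\<epsilon> > 0\<close> power2_less_imp_less by fastforce
    qed
    then show "\<exists>N. \<forall>n n'. N \<le> n \<longrightarrow> N \<le> n' \<longrightarrow> ip_dist V (x n) (x n') < \<epsilon>" by blast
  qed
  then obtain r where "limitin mtopology x r sequentially"
    using complete unfolding mcomplete_def by blast
  then have r: "r \<in> carrier V" and lim: "(\<lambda>n. ip_dist V (x n) r) \<longlonglongrightarrow> 0"
    by (auto simp: limitin_metric_dist_null)
  have Re_eq: "Re (\<phi> v) = Re (ip V v r)" if v: "v \<in> carrier V" for v
  proof -
    define b where "b = (ip_norm V v)\<^sup>2"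
    define a where "a n = Re (ip V v (x n)) - Re (\<phi> v)" for n
    have b: "b \<ge> 0" by (simp add: b_def)
    have "(a n)\<^sup>2 \<le> 2 * (b + 1) * (1 / real (Suc n))" for n
    proof -
      \<comment> \<open>In direction \<open>v\<close> the energy grows by \<open>t * a n + t\<^sup>2 * b / 2\<close>. Its minimum would be at
        \<open>t = - a n / b\<close>; the denominator \<open>b + 1\<close> also covers \<open>b = 0\<close>.\<close>
      define t where "t = - (a n / (b + 1))"
      have tv: "of_real t \<odot> v \<in> carrier V" using v by (rule smult_closed_complex)
      have "Re (ip V (x n) v) = Re (ip V v (x n))" using ip_commute[OF x[of n] v] by simp
      then have "E (x n \<oplus> of_real t \<odot> v) = E (x n) + t * a n + t\<^sup>2 * b / 2"
        using x[of n] v tv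
        by (simp add: E_def norm_sq_add norm_sq_smult ip_smult_right add smult a_def b_def
            algebra_simps add_divide_distrib)
      moreover have "m \<le> E (x n \<oplus> of_real t \<odot> v)" using m x tv by simp
      ultimately have "0 \<le> 1 / real (Suc n) + (t * a n + t\<^sup>2 * b / 2)"
        using xm[of n] by linarith
      moreover have "t * a n + t\<^sup>2 * b / 2 \<le> - ((a n)\<^sup>2 / (2 * (b + 1)))"
      proof -
        define q where "q = (a n)\<^sup>2 / (b + 1)"
        define w where "w = q * (b / (b + 1))"
        have "t * a n = - q" by (simp add: t_def q_def power2_eq_square)
        moreover have "t\<^sup>2 * b / 2 = w / 2"
          by (simp add: t_def q_def w_def power2_eq_square)
        moreover have "w \<le> q * 1"
          unfolding w_def using b by (intro mult_left_mono) (auto simp: q_def)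
        moreover have "(a n)\<^sup>2 / (2 * (b + 1)) = q / 2" by (simp add: q_def)
        ultimately show ?thesis by linarith
      qed
      ultimately have "(a n)\<^sup>2 / (2 * (b + 1)) \<le> 1 / real (Suc n)" by linarith
      then show ?thesis using b by (simp add: divide_le_eq mult.commute)
    qed
    moreover have "(\<lambda>n. 2 * (b + 1) * (1 / real (Suc n))) \<longlonglongrightarrow> 2 * (b + 1) * 0"
      by (intro tendsto_mult tendsto_const LIMSEQ_Suc[OF lim_1_over_n])
    moreover have "(\<lambda>n. (a n)\<^sup>2) \<longlonglongrightarrow> (Re (ip V v r) - Re (\<phi> v))\<^sup>2"
    proof -
      have "(\<lambda>n. ip V v (x n) - ip V v r) \<longlonglongrightarrow> 0"
      proof (rule Lim_null_comparison)
        show "\<forall>\<^sub>F n in sequentially. cmod (ip V v (x n) - ip V v r) \<le> ip_norm V v * ip_dist V (x n) r"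
          using x r v Cauchy_Schwarz[OF v, of "x _ \<ominus> r"]
          by (intro always_eventually) (simp add: ip_diff_right ip_dist_def)
        show "(\<lambda>n. ip_norm V v * ip_dist V (x n) r) \<longlonglongrightarrow> 0"
          using tendsto_mult_right_zero[OF lim] .
      qed
      then have "(\<lambda>n. ip V v (x n)) \<longlonglongrightarrow> ip V v r" by (simp add: LIM_zero_iff)
      then show ?thesis unfolding a_def by (intro tendsto_intros)
    qed
    ultimately have "(Re (ip V v r) - Re (\<phi> v))\<^sup>2 \<le> 2 * (b + 1) * 0"
      by (intro LIMSEQ_le) auto
    then show ?thesis by simp
  qed
  have "\<phi> v = ip V v r" if v: "v \<in> carrier V" for v
  proof (rule complex_eqI)
    show "Re (\<phi> v) = Re (ip V v r)" using v by (rule Re_eq)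
    \<comment> \<open>The real part at \<open>\<i> \<odot> v\<close> is minus the imaginary part at \<open>v\<close>.\<close>
    show "Im (\<phi> v) = Im (ip V v r)"
      using Re_eq[OF smult_closed_complex[OF v, of \<i>]] v r by (simp add: smult ip_smult_left)
  qed
  then show ?thesis using r by blast
qed

end


section \<open>Bounded operators and their adjoints\<close>

lemma bounded_ops_closed: "\<lbrakk>A \<in> bounded_ops V W; x \<in> carrier V\<rbrakk> \<Longrightarrow> A x \<in> carrier W"
  by (auto simp: bounded_ops_def)

lemma bounded_ops_add:
  "\<lbrakk>A \<in> bounded_ops V W; x \<in> carrier V; y \<in> carrier V\<rbrakk> \<Longrightarrow> A (x \<oplus>\<^bsub>V\<^esub> y) = A x \<oplus>\<^bsub>W\<^esub> A y"
  by (auto simp: bounded_ops_def)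

lemma bounded_ops_smult:
  "\<lbrakk>A \<in> bounded_ops V W; x \<in> carrier V\<rbrakk> \<Longrightarrow> A (c \<odot>\<^bsub>V\<^esub> x) = c \<odot>\<^bsub>W\<^esub> A x"
  by (auto simp: bounded_ops_def)

lemma bounded_ops_bound:
  assumes "complex_inner_space V" "A \<in> bounded_ops V W"
  obtains C where "C \<ge> 0" "\<And>x. x \<in> carrier V \<Longrightarrow> ip_norm W (A x) \<le> C * ip_norm V x"
proof -
  interpret complex_inner_space V by fact
  obtain C where C: "\<And>x. x \<in> carrier V \<Longrightarrow> ip_norm W (A x) \<le> C * ip_norm V x"
    using assms(2) unfolding bounded_ops_def by blast
  have "ip_norm W (A x) \<le> \<bar>C\<bar> * ip_norm V x" if "x \<in> carrier V" for x
    using C[OF that] mult_right_mono[OF abs_ge_self[of C] ip_norm_nonneg[OF that]] by linarith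
  then show thesis using that[of "\<bar>C\<bar>"] by simp
qed

lemma bounded_ops_comp:
  assumes V: "complex_inner_space V" and W: "complex_inner_space W"
    and A: "A \<in> bounded_ops V W" and B: "B \<in> bounded_ops W X"
  shows "B \<circ> A \<in> bounded_ops V X"
proof -
  obtain a where a: "a \<ge> 0" "\<And>x. x \<in> carrier V \<Longrightarrow> ip_norm W (A x) \<le> a * ip_norm V x"
    using bounded_ops_bound[OF V A] by blast
  obtain b where b: "b \<ge> 0" "\<And>x. x \<in> carrier W \<Longrightarrow> ip_norm X (B x) \<le> b * ip_norm W x"
    using bounded_ops_bound[OF W B] by blast
  have "ip_norm X (B (A x)) \<le> b * a * ip_norm V x" if "x \<in> carrier V" for x
    using b(2)[OF bounded_ops_closed[OF A that]] mult_left_mono[OF a(2)[OF that] b(1)] by simp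
  then have "\<exists>C. \<forall>x\<in>carrier V. ip_norm X ((B \<circ> A) x) \<le> C * ip_norm V x" by auto
  then show ?thesis
    unfolding bounded_ops_def[of V X]
    using A B by (simp add: Pi_iff bounded_ops_closed[OF A] bounded_ops_add[OF A] bounded_ops_smult[OF A]
        bounded_ops_closed[OF B] bounded_ops_add[OF B] bounded_ops_smult[OF B])
qed

text \<open>
  The operator \<^const>\<open>adj\<close> is a definite description; it has the expected value because the
  functional \<open>v \<mapsto> \<langle>A v, y\<rangle>\<close> is bounded, hence represented by a vector of the complete space \<open>V\<close>,
  and this vector is unique.
\<close>

lemma adjoint_exists:
  assumes V: "separable_hilbert_space V" and W: "complex_inner_space W"
    and A: "A \<in> bounded_ops V W" and y: "y \<in> carrier W"
  shows "adj V W A y \<in> carrier V \<and> (\<forall>v\<in>carrier V. ip W (A v) y = ip V v (adj V W A y))"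
proof -
  interpret V: separable_hilbert_space V by fact
  interpret W: complex_inner_space W by fact
  obtain C where C: "\<And>x. x \<in> carrier V \<Longrightarrow> ip_norm W (A x) \<le> C * ip_norm V x"
    using bounded_ops_bound[OF V.complex_inner_space_axioms A] by blast
  have "\<exists>r\<in>carrier V. \<forall>v\<in>carrier V. ip W (A v) y = ip V v r"
  proof (rule V.riesz_representation[OF V.complete])
    fix x assume x: "x \<in> carrier V"
    have "cmod (ip W (A x) y) \<le> ip_norm W (A x) * ip_norm W y"
      using bounded_ops_closed[OF A x] y by (rule W.Cauchy_Schwarz)
    also have "\<dots> \<le> C * ip_norm V x * ip_norm W y"
      using C[OF x] W.ip_norm_nonneg[OF y] by (rule mult_right_mono)
    finally show "cmod (ip W (A x) y) \<le> (C * ip_norm W y) * ip_norm V x" by (simp add: mult_ac)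
  qed (use y in \<open>simp_all add: bounded_ops_closed[OF A] bounded_ops_add[OF A]
      bounded_ops_smult[OF A] W.ip_add_left W.ip_smult_left\<close>)
  then obtain r where r: "r \<in> carrier V" "\<And>v. v \<in> carrier V \<Longrightarrow> ip W (A v) y = ip V v r"
    by blast
  have "\<exists>!r. r \<in> carrier V \<and> (\<forall>v\<in>carrier V. ip W (A v) y = ip V v r)"
  proof (rule ex1I[of _ r])
    show "r' = r" if "r' \<in> carrier V \<and> (\<forall>v\<in>carrier V. ip W (A v) y = ip V v r')" for r'
      using that r by (intro V.eq_if_ip_eq) auto
  qed (use r in blast)
  from theI'[OF this] show ?thesis unfolding adj_def .
qed

lemma adj_closed:
  "\<lbrakk>separable_hilbert_space V; complex_inner_space W; A \<in> bounded_ops V W; y \<in> carrier W\<rbrakk>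
    \<Longrightarrow> adj V W A y \<in> carrier V"
  by (rule adjoint_exists[THEN conjunct1])

lemma ip_adj_right:
  "\<lbrakk>separable_hilbert_space V; complex_inner_space W; A \<in> bounded_ops V W;
    v \<in> carrier V; y \<in> carrier W\<rbrakk>
    \<Longrightarrow> ip V v (adj V W A y) = ip W (A v) y"
  by (rule adjoint_exists[THEN conjunct2, THEN bspec, symmetric])

lemma ip_adj_left:
  assumes "separable_hilbert_space V" "complex_inner_space W" "A \<in> bounded_ops V W"
    "v \<in> carrier V" "y \<in> carrier W"
  shows "ip V (adj V W A y) v = ip W y (A v)"
proof -
  interpret V: separable_hilbert_space V by fact
  interpret W: complex_inner_space W by fact
  have "ip V (adj V W A y) v = cnj (ip V v (adj V W A y))"
    using adj_closed[OF assms(1-3,5)] assms(4) by (intro V.ip_commute)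
  also have "\<dots> = cnj (ip W (A v) y)" using ip_adj_right[OF assms] by simp
  also have "\<dots> = ip W y (A v)"
    using W.ip_commute[OF bounded_ops_closed[OF assms(3,4)] assms(5)] by simp
  finally show ?thesis .
qed

text \<open>
  The norm bound comes from \<open>\<parallel>A\<^sup>* y\<parallel>\<^sup>2 = \<langle>A A\<^sup>* y, y\<rangle> \<le> C \<parallel>A\<^sup>* y\<parallel> \<parallel>y\<parallel>\<close>.
\<close>

lemma adj_bounded:
  assumes V: "separable_hilbert_space V" and W: "complex_inner_space W" and A: "A \<in> bounded_ops V W"
  shows "adj V W A \<in> bounded_ops W V"
proof -
  interpret V: separable_hilbert_space V by fact
  interpret W: complex_inner_space W by fact
  note closed = adj_closed[OF V W A] and right = ip_adj_right[OF V W A]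
  obtain C where C: "C \<ge> 0" "\<And>x. x \<in> carrier V \<Longrightarrow> ip_norm W (A x) \<le> C * ip_norm V x"
    using bounded_ops_bound[OF V.complex_inner_space_axioms A] by blast
  have add: "adj V W A (x \<oplus>\<^bsub>W\<^esub> y) = adj V W A x \<oplus>\<^bsub>V\<^esub> adj V W A y"
    if "x \<in> carrier W" "y \<in> carrier W" for x y
    using that bounded_ops_closed[OF A]
    by (intro V.eq_if_ip_eq) (simp_all add: closed right V.ip_add_right W.ip_add_right)
  have smult: "adj V W A (c \<odot>\<^bsub>W\<^esub> y) = c \<odot>\<^bsub>V\<^esub> adj V W A y" if "y \<in> carrier W" for c y
    using that bounded_ops_closed[OF A]
    by (intro V.eq_if_ip_eq) (simp_all add: closed right V.ip_smult_right W.ip_smult_right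
        V.smult_closed_complex W.smult_closed_complex)
  have bound: "ip_norm V (adj V W A y) \<le> C * ip_norm W y" if y: "y \<in> carrier W" for y
  proof -
    let ?z = "adj V W A y"
    have z: "?z \<in> carrier V" using y by (rule closed)
    have "(ip_norm V ?z)\<^sup>2 = Re (ip W (A ?z) y)"
      using right[OF z y] V.norm_sq[OF z] by simp
    also have "\<dots> \<le> ip_norm W (A ?z) * ip_norm W y"
      using W.Cauchy_Schwarz[OF bounded_ops_closed[OF A z] y]
        complex_Re_le_cmod[of "ip W (A ?z) y"] by linarith
    also have "\<dots> \<le> C * ip_norm V ?z * ip_norm W y"
      using C(2)[OF z] W.ip_norm_nonneg[OF y] by (rule mult_right_mono)
    finally have "ip_norm V ?z * ip_norm V ?z \<le> ip_norm V ?z * (C * ip_norm W y)"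
      by (simp add: power2_eq_square mult_ac)
    then show ?thesis
      using C(1) W.ip_norm_nonneg[OF y] V.ip_norm_nonneg[OF z]
      by (cases "ip_norm V ?z = 0") auto
  qed
  show ?thesis
    unfolding bounded_ops_def using closed add smult bound by blast
qed


section \<open>Invertible operators\<close>

text \<open>
  A two-sided inverse \<open>B\<close> on the carrier agrees with \<^const>\<open>op_inv\<close> only there; that is enough,
  as membership in \<^const>\<open>bounded_ops\<close> depends on the values on the carrier alone.
\<close>

lemma GL_I:
  assumes A: "A \<in> bounded_ops V V" and B: "B \<in> bounded_ops V V"
    and V: "complex_inner_space V"
    and AB: "\<And>x. x \<in> carrier V \<Longrightarrow> A (B x) = x" and BA: "\<And>x. x \<in> carrier V \<Longrightarrow> B (A x) = x"
  shows "A \<in> GL V"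
proof -
  interpret complex_inner_space V by fact
  have bij: "bij_betw A (carrier V) (carrier V)"
    using bounded_ops_closed[OF A] bounded_ops_closed[OF B] AB BA
    by (intro bij_betwI[of _ _ _ B]) auto
  have inv: "op_inv V A x = B x" if "x \<in> carrier V" for x
    unfolding op_inv_def
    using bij_betw_imp_inj_on[OF bij] bounded_ops_closed[OF B that] AB[OF that]
    by (rule inv_into_f_eq)
  have "op_inv V A \<in> bounded_ops V V"
    using B unfolding bounded_ops_def by (simp add: Pi_iff inv smult_closed_complex)
  then show ?thesis using A bij by (simp add: GL_def)
qed

lemma GL_bounded: "A \<in> GL V \<Longrightarrow> A \<in> bounded_ops V V"
  and GL_inv_bounded: "A \<in> GL V \<Longrightarrow> op_inv V A \<in> bounded_ops V V"
  by (simp_all add: GL_def)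

lemma GL_right_inv: "\<lbrakk>A \<in> GL V; x \<in> carrier V\<rbrakk> \<Longrightarrow> A (op_inv V A x) = x"
  unfolding GL_def op_inv_def by (blast intro: bij_betw_inv_into_right)

lemma GL_left_inv: "\<lbrakk>A \<in> GL V; x \<in> carrier V\<rbrakk> \<Longrightarrow> op_inv V A (A x) = x"
  unfolding GL_def op_inv_def by (blast intro: bij_betw_inv_into_left)

lemma GL_op_inv:
  assumes "complex_inner_space V" "A \<in> GL V"
  shows "op_inv V A \<in> GL V"
  using assms by (intro GL_I[of _ _ A]) (simp_all add: GL_bounded GL_inv_bounded GL_left_inv GL_right_inv)

lemma GL_comp:
  assumes V: "complex_inner_space V" and A: "A \<in> GL V" and B: "B \<in> GL V"
  shows "B \<circ> A \<in> GL V"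
proof (rule GL_I)
  show "B \<circ> A \<in> bounded_ops V V" "op_inv V A \<circ> op_inv V B \<in> bounded_ops V V"
    using bounded_ops_comp[OF V V] GL_bounded[OF A] GL_bounded[OF B] GL_inv_bounded[OF A]
      GL_inv_bounded[OF B] by blast+
qed (simp_all add: V GL_left_inv[OF A] GL_right_inv[OF A] GL_left_inv[OF B] GL_right_inv[OF B]
    bounded_ops_closed[OF GL_bounded[OF A]] bounded_ops_closed[OF GL_inv_bounded[OF A]]
    bounded_ops_closed[OF GL_bounded[OF B]] bounded_ops_closed[OF GL_inv_bounded[OF B]])

text \<open>
  Taking adjoints reverses products, so the adjoint of the inverse is inverse to the adjoint.
\<close>

lemma GL_adj:
  assumes V: "separable_hilbert_space V" and A: "A \<in> GL V"
  shows "adj V V A \<in> GL V"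
proof -
  interpret V: separable_hilbert_space V by fact
  note VC = V.complex_inner_space_axioms
  note Ab = GL_bounded[OF A] and Bb = GL_inv_bounded[OF A]
  note simps = adj_closed[OF V VC Ab] adj_closed[OF V VC Bb] ip_adj_right[OF V VC Ab]
    ip_adj_right[OF V VC Bb] bounded_ops_closed[OF Ab] bounded_ops_closed[OF Bb]
    GL_left_inv[OF A] GL_right_inv[OF A]
  show ?thesis
  proof (rule GL_I[OF adj_bounded[OF V VC Ab] adj_bounded[OF V VC Bb] VC])
    fix x assume "x \<in> carrier V"
    then show "adj V V A (adj V V (op_inv V A) x) = x" "adj V V (op_inv V A) (adj V V A x) = x"
      by (auto intro!: V.eq_if_ip_eq simp: simps)
  qed
qed


section \<open>Parseval's identity\<close>

context complex_inner_space
begin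

lemma lincomb_closed:
  assumes "e \<in> F \<rightarrow> carrier V"
  shows "(\<Oplus>j\<in>F. c j \<odot> e j) \<in> carrier V"
  using assms by (intro M.finsum_closed) (auto intro: smult_closed_complex)

lemma ip_lincomb_left:
  assumes "finite F" "e \<in> F \<rightarrow> carrier V" "y \<in> carrier V"
  shows "ip V (\<Oplus>j\<in>F. c j \<odot> e j) y = (\<Sum>j\<in>F. c j * ip V (e j) y)"
  using assms
proof (induction F rule: finite_induct)
  case (insert k F)
  then have "(\<Oplus>j\<in>insert k F. c j \<odot> e j) = c k \<odot> e k \<oplus> (\<Oplus>j\<in>F. c j \<odot> e j)"
    by (intro M.finsum_insert) (auto intro: smult_closed_complex)
  with insert show ?case
    using lincomb_closed[of e F c]
    by (simp add: ip_add_left ip_smult_left smult_closed_complex)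
qed (simp add: ip_zero_left)

text \<open>
  The residual \<open>z\<close> of the orthogonal projection \<open>p\<close> is orthogonal to every combination of the
  \<open>e j\<close> with \<open>j \<in> F\<close>. So for such a combination \<open>s\<close>, Pythagoras' theorem applies to
  \<open>x - s = z + (p - s)\<close>.
\<close>

lemma best_approximation:
  assumes F: "finite F" and e: "e \<in> F \<rightarrow> carrier V" and x: "x \<in> carrier V"
    and on: "\<And>j k. \<lbrakk>j \<in> F; k \<in> F\<rbrakk> \<Longrightarrow> ip V (e j) (e k) = (if j = k then 1 else 0)"
    and G: "G \<subseteq> F"
  shows "ip_norm V (x \<ominus> (\<Oplus>j\<in>F. ip V x (e j) \<odot> e j)) \<le> ip_norm V (x \<ominus> (\<Oplus>j\<in>G. c j \<odot> e j))"
proof -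
  define p where "p = (\<Oplus>j\<in>F. ip V x (e j) \<odot> e j)"
  define s where "s = (\<Oplus>j\<in>G. c j \<odot> e j)"
  define z where "z = x \<ominus> p"
  have eG: "e \<in> G \<rightarrow> carrier V" using e G by auto
  have p: "p \<in> carrier V" and s: "s \<in> carrier V"
    unfolding p_def s_def by (rule lincomb_closed[OF e], rule lincomb_closed[OF eG])
  have z: "z \<in> carrier V" unfolding z_def using x p by (rule M.minus_closed)
  have ps: "p \<ominus> s \<in> carrier V" using p s by (rule M.minus_closed)
  have ez: "ip V (e k) z = 0" if k: "k \<in> F" for k
  proof -
    have ek: "e k \<in> carrier V" using e k by auto
    have "ip V p (e k) = (\<Sum>j\<in>F. ip V x (e j) * ip V (e j) (e k))"
      unfolding p_def by (rule ip_lincomb_left[OF F e ek])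
    also have "\<dots> = (\<Sum>j\<in>F. if j = k then ip V x (e j) else 0)"
    proof (rule sum.cong)
      show "ip V x (e j) * ip V (e j) (e k) = (if j = k then ip V x (e j) else 0)" if "j \<in> F" for j
        unfolding on[OF that k] by simp
    qed (rule refl)
    also have "\<dots> = ip V x (e k)" using F k by simp
    finally have "ip V z (e k) = 0" unfolding z_def ip_diff_left[OF x p ek] by simp
    then show ?thesis using ip_commute[OF z ek] by simp
  qed
  have "ip V p z = 0"
    unfolding p_def ip_lincomb_left[OF F e z] by (intro sum.neutral ballI) (simp add: ez)
  moreover have "ip V s z = 0"
    unfolding s_def ip_lincomb_left[OF finite_subset[OF G F] eG z]
    by (intro sum.neutral ballI) (simp add: ez[OF subsetD[OF G]])
  ultimately have "ip V (p \<ominus> s) z = 0" unfolding ip_diff_left[OF p s z] by simp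
  then have "ip V z (p \<ominus> s) = 0" using ip_commute[OF ps z] by simp
  moreover have "x \<ominus> s = z \<oplus> (p \<ominus> s)"
    using x p s by (simp add: z_def M.minus_eq M.a_assoc M.r_neg1)
  ultimately have "(ip_norm V z)\<^sup>2 \<le> (ip_norm V (x \<ominus> s))\<^sup>2"
    using norm_sq_add[OF z ps] by simp
  then show ?thesis
    unfolding p_def[symmetric] s_def[symmetric] z_def[symmetric]
    by (rule power2_le_imp_le) (rule ip_norm_nonneg[OF M.minus_closed[OF x s]])
qed

text \<open>
  By density some combination of finitely many basis vectors is close to \<open>x\<close>. Every larger
  partial sum of the Fourier series of \<open>x\<close> is at least as close, by best approximation; pairing
  with \<open>y\<close> turns this into convergence along the net of finite subsets, that is, unconditional
  convergence.
\<close>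

lemma parseval:
  assumes e: "orthonormal_basis V J e" and x: "x \<in> carrier V" and y: "y \<in> carrier V"
  shows "((\<lambda>j. ip V x (e j) * ip V (e j) y) has_sum ip V x y) J"
  unfolding has_sum_def tendsto_iff eventually_finite_subsets_at_top
proof (intro allI impI)
  fix \<epsilon> :: real assume \<epsilon>: "\<epsilon> > 0"
  have eJ: "e \<in> J \<rightarrow> carrier V"
    and on: "\<And>j k. \<lbrakk>j \<in> J; k \<in> J\<rbrakk> \<Longrightarrow> ip V (e j) (e k) = (if j = k then 1 else 0)"
    and dense: "x \<in> mtopology closure_of {\<Oplus>j\<in>F. c j \<odot> e j | F c. finite F \<and> F \<subseteq> J}"
    using e x unfolding orthonormal_basis_def by blast+
  \<comment> \<open>Pairing with \<open>y\<close> costs a factor \<open>\<parallel>y\<parallel>\<close>; adding 1 avoids division by zero.\<close>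
  define \<delta> where "\<delta> = \<epsilon> / (ip_norm V y + 1)"
  have \<delta>: "\<delta> > 0" "\<delta> * ip_norm V y < \<epsilon>"
  proof -
    have pos: "ip_norm V y + 1 > 0" using ip_norm_nonneg[OF y] by simp
    show "\<delta> > 0" using \<epsilon> pos by (simp add: \<delta>_def)
    have "\<delta> * (ip_norm V y + 1) = \<epsilon>" using pos by (simp add: \<delta>_def)
    then show "\<delta> * ip_norm V y < \<epsilon>" using \<open>\<delta> > 0\<close> by (simp add: distrib_left)
  qed
  obtain G c where G: "finite G" "G \<subseteq> J" and near: "ip_dist V x (\<Oplus>j\<in>G. c j \<odot> e j) < \<delta>"
  proof -
    have "\<exists>y\<in>{\<Oplus>j\<in>F. c j \<odot> e j | F c. finite F \<and> F \<subseteq> J}. y \<in> mball x \<delta>"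
      using dense \<delta>(1) unfolding metric_closure_of by blast
    then show thesis using that unfolding in_mball by blast
  qed
  show "\<exists>X. finite X \<and> X \<subseteq> J \<and> (\<forall>Y. finite Y \<and> X \<subseteq> Y \<and> Y \<subseteq> J \<longrightarrow>
      dist (\<Sum>j\<in>Y. ip V x (e j) * ip V (e j) y) (ip V x y) < \<epsilon>)"
  proof (intro exI[of _ G] conjI allI impI)
    fix F assume F: "finite F \<and> G \<subseteq> F \<and> F \<subseteq> J"
    define p where "p = (\<Oplus>j\<in>F. ip V x (e j) \<odot> e j)"
    have eF: "e \<in> F \<rightarrow> carrier V" and eG: "e \<in> G \<rightarrow> carrier V" using eJ F by auto
    have p: "p \<in> carrier V" using eF by (auto simp: p_def intro: lincomb_closed)
    have "ip_norm V (x \<ominus> p) \<le> ip_norm V (x \<ominus> (\<Oplus>j\<in>G. c j \<odot> e j))"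
      unfolding p_def
    proof (rule best_approximation)
      show "ip V (e j) (e k) = (if j = k then 1 else 0)" if "j \<in> F" "k \<in> F" for j k
        using that F by (intro on) auto
    qed (use F eF x in auto)
    also have "\<dots> < \<delta>" using near x lincomb_closed[OF eG, of c] by (simp add: ip_dist_def)
    finally have close: "ip_norm V (x \<ominus> p) \<le> \<delta>" by simp
    have "ip V p y = (\<Sum>j\<in>F. ip V x (e j) * ip V (e j) y)"
      unfolding p_def using F eF y by (intro ip_lincomb_left) auto
    then have "dist (\<Sum>j\<in>F. ip V x (e j) * ip V (e j) y) (ip V x y) = cmod (ip V (x \<ominus> p) y)"
      using x y p by (simp add: ip_diff_left dist_norm norm_minus_commute)
    also have "\<dots> \<le> ip_norm V (x \<ominus> p) * ip_norm V y"
      using x p y by (intro Cauchy_Schwarz) simp_all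
    also have "\<dots> \<le> \<delta> * ip_norm V y"
      using close ip_norm_nonneg[OF y] by (rule mult_right_mono)
    also have "\<dots> < \<epsilon>" by (rule \<delta>)
    finally show "dist (\<Sum>j\<in>F. ip V x (e j) * ip V (e j) y) (ip V x y) < \<epsilon>" .
  qed (use G in auto)
qed

end


section \<open>The Bessel bound by polarization\<close>

text \<open>
  The usual polarization identity for the sesquilinear form \<open>\<langle>A f, B g\<rangle>\<close>: weighting by \<open>k\<close> the
  values at \<open>f + k g\<close>, for the fourth roots of unity \<open>k\<close>, cancels all but the mixed term linear
  in \<open>f\<close>.
\<close>

lemma polarization:
  fixes V :: "'v inner_module" and W :: "'w inner_module"
  assumes V: "complex_inner_space V" and W: "complex_inner_space W"
    and A: "A \<in> bounded_ops V W" and B: "B \<in> bounded_ops V W"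
    and f: "f \<in> carrier V" and g: "g \<in> carrier V"
  defines "q \<equiv> \<lambda>k. ip W (A (f \<oplus>\<^bsub>V\<^esub> k \<odot>\<^bsub>V\<^esub> g)) (B (f \<oplus>\<^bsub>V\<^esub> k \<odot>\<^bsub>V\<^esub> g))"
  shows "ip W (A f) (B g) = (q 1 + (-1) * q (-1) + \<i> * q \<i> + (-\<i>) * q (-\<i>)) / 4"
proof -
  interpret V: complex_inner_space V by fact
  interpret W: complex_inner_space W by fact
  have q: "q k = ip W (A f) (B f) + cnj k * ip W (A f) (B g) + k * ip W (A g) (B f)
      + k * cnj k * ip W (A g) (B g)" for k
    using f g
    by (simp add: q_def bounded_ops_add[OF A] bounded_ops_smult[OF A] bounded_ops_closed[OF A]
        bounded_ops_add[OF B] bounded_ops_smult[OF B] bounded_ops_closed[OF B]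
        V.smult_closed_complex W.smult_closed_complex W.ip_add_left W.ip_add_right
        W.ip_smult_left W.ip_smult_right algebra_simps)
  show ?thesis unfolding q by (simp add: algebra_simps)
qed

text \<open>
  For \<open>f = T\<^sup>-\<^sup>1 h\<close> and \<open>g = U\<^sup>-\<^sup>1 h\<close> the mixed term \<open>\<langle>\<Lambda> i T f, \<Lambda> i U g\<rangle>\<close> is \<open>\<parallel>\<Lambda> i h\<parallel>\<^sup>2\<close>. Polarization
  writes it through the diagonal terms at \<open>f + k g\<close>, whose sums \<open>s (f + k g)\<close> are real. Hence the
  two summands with factor \<open>\<i>\<close> contribute nothing to the real part, and
  \<open>\<Sum>i. \<parallel>\<Lambda> i h\<parallel>\<^sup>2 = (s (f + g) - s (f - g)) / 4 \<le> s (f + g) / 4\<close>, where \<open>\<parallel>f + g\<parallel>\<close> is at most \<open>\<parallel>h\<parallel>\<close> times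
  the sum of the operator bounds of \<open>T\<^sup>-\<^sup>1\<close> and \<open>U\<^sup>-\<^sup>1\<close>.
\<close>

lemma g_bessel_if_upper_bound:
  fixes H :: "'v inner_module" and K :: "int \<Rightarrow> 'w inner_module"
  assumes H: "complex_inner_space H" and K: "\<And>i. i \<in> I \<Longrightarrow> complex_inner_space (K i)"
    and T: "T \<in> GL H" and U: "U \<in> GL H"
    and \<Lambda>: "\<And>i. i \<in> I \<Longrightarrow> \<Lambda> i \<in> bounded_ops H (K i)"
    and sum: "\<And>f. f \<in> carrier H \<Longrightarrow>
      ((\<lambda>i. ip (K i) (\<Lambda> i (T f)) (\<Lambda> i (U f))) has_sum complex_of_real (s f)) I"
    and nonneg: "\<And>f. f \<in> carrier H \<Longrightarrow> 0 \<le> s f"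
    and upper: "\<And>f. f \<in> carrier H \<Longrightarrow> s f \<le> B * (ip_norm H f)\<^sup>2"
    and B: "0 \<le> B"
  shows "g_bessel H I K \<Lambda>"
proof -
  interpret H: complex_inner_space H by fact
  obtain a where a: "\<And>x. x \<in> carrier H \<Longrightarrow> ip_norm H (op_inv H T x) \<le> a * ip_norm H x"
    using bounded_ops_bound[OF H GL_inv_bounded[OF T]] by blast
  obtain b where b: "\<And>x. x \<in> carrier H \<Longrightarrow> ip_norm H (op_inv H U x) \<le> b * ip_norm H x"
    using bounded_ops_bound[OF H GL_inv_bounded[OF U]] by blast
  define D where "D = B * (a + b)\<^sup>2 / 4"
  have "(\<lambda>i. (ip_norm (K i) (\<Lambda> i h))\<^sup>2) summable_on I \<and>
      (\<Sum>\<^sub>\<infinity>i\<in>I. (ip_norm (K i) (\<Lambda> i h))\<^sup>2) \<le> D * (ip_norm H h)\<^sup>2" if h: "h \<in> carrier H" for h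
  proof -
    define f where "f = op_inv H T h"
    define g where "g = op_inv H U h"
    have f: "f \<in> carrier H" and g: "g \<in> carrier H"
      using h bounded_ops_closed[OF GL_inv_bounded[OF T]] bounded_ops_closed[OF GL_inv_bounded[OF U]]
      by (simp_all add: f_def g_def)
    define x where "x k = f \<oplus>\<^bsub>H\<^esub> k \<odot>\<^bsub>H\<^esub> g" for k
    have x: "x k \<in> carrier H" for k using f g by (simp add: x_def H.smult_closed_complex)
    define q where "q k i = ip (K i) (\<Lambda> i (T (x k))) (\<Lambda> i (U (x k)))" for k i
    define S where "S = (complex_of_real (s (x 1)) + (-1) * complex_of_real (s (x (-1)))
        + \<i> * complex_of_real (s (x \<i>)) + (-\<i>) * complex_of_real (s (x (-\<i>)))) * (1 / 4)"
    have "(q k has_sum complex_of_real (s (x k))) I" for k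
      unfolding q_def using sum[OF x] by simp
    then have S: "((\<lambda>i. (q 1 i + (-1) * q (-1) i + \<i> * q \<i> i + (-\<i>) * q (-\<i>) i) * (1 / 4))
        has_sum S) I"
      unfolding S_def by (intro has_sum_cmult_left has_sum_add has_sum_cmult_right)
    have eq: "(q 1 i + (-1) * q (-1) i + \<i> * q \<i> i + (-\<i>) * q (-\<i>) i) * (1 / 4)
        = complex_of_real ((ip_norm (K i) (\<Lambda> i h))\<^sup>2)" if i: "i \<in> I" for i
    proof -
      interpret K: complex_inner_space "K i" using i by (rule K)
      have "ip (K i) ((\<Lambda> i \<circ> T) f) ((\<Lambda> i \<circ> U) g)
          = (q 1 i + (-1) * q (-1) i + \<i> * q \<i> i + (-\<i>) * q (-\<i>) i) / 4"
        using polarization[OF H K[OF i] bounded_ops_comp[OF H H GL_bounded[OF T] \<Lambda>[OF i]]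
            bounded_ops_comp[OF H H GL_bounded[OF U] \<Lambda>[OF i]] f g]
        by (simp add: q_def x_def)
      moreover have "T f = h" "U g = h"
        using h T U by (simp_all add: f_def g_def GL_right_inv)
      ultimately show ?thesis
        using K.ip_self[OF bounded_ops_closed[OF \<Lambda>[OF i] h]] by simp
    qed
    have "((\<lambda>i. complex_of_real ((ip_norm (K i) (\<Lambda> i h))\<^sup>2)) has_sum S) I"
      using has_sum_cong[THEN iffD1, OF eq S] .
    from has_sum_Re[OF this]
    have hs: "((\<lambda>i. (ip_norm (K i) (\<Lambda> i h))\<^sup>2) has_sum (s (x 1) - s (x (-1))) / 4) I"
      by (simp add: S_def)
    have "ip_norm H (x 1) \<le> ip_norm H f + ip_norm H (1 \<odot>\<^bsub>H\<^esub> g)"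
      unfolding x_def using f g by (intro H.ip_norm_triangle) (simp_all add: H.smult_closed_complex)
    also have "\<dots> \<le> (a + b) * ip_norm H h"
      using a[OF h] b[OF h] g by (simp add: H.norm_smult f_def g_def algebra_simps)
    finally have "(ip_norm H (x 1))\<^sup>2 \<le> ((a + b) * ip_norm H h)\<^sup>2"
      using H.ip_norm_nonneg[OF x] by (intro power_mono)
    then have "s (x 1) \<le> B * ((a + b) * ip_norm H h)\<^sup>2"
      using upper[OF x, of 1] B mult_left_mono order_trans by blast
    then have "(s (x 1) - s (x (-1))) / 4 \<le> D * (ip_norm H h)\<^sup>2"
      using nonneg[OF x, of "-1"] by (simp add: D_def power_mult_distrib)
    then show ?thesis using hs by (auto simp: infsumI summable_on_def)
  qed
  then show ?thesis using \<Lambda> unfolding g_bessel_def by blast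
qed


section \<open>Controlled g-frames and controlled frames\<close>

text \<open>
  With the inner sums evaluated by Parseval's identity, both sides state the same estimates for
  the same series; the g-Bessel property on the left follows from them by the preceding lemma.
\<close>

theorem theorem2p8:
  fixes H :: "'v inner_module"
    and I :: "int set"
    and K :: "int \<Rightarrow> 'w inner_module"
    and T U :: "'v \<Rightarrow> 'v"
    and \<Lambda> :: "int \<Rightarrow> 'v \<Rightarrow> 'w"
    and J :: "int \<Rightarrow> 'j set"
    and e :: "int \<Rightarrow> 'j \<Rightarrow> 'w"
    and u :: "int \<Rightarrow> 'j \<Rightarrow> 'v"
  assumes "separable_hilbert_space H"
    and "\<And>i. i \<in> I \<Longrightarrow> separable_hilbert_space (K i)"
    and "T \<in> GL H" and "U \<in> GL H"
    and "\<And>i. i \<in> I \<Longrightarrow> \<Lambda> i \<in> bounded_ops H (K i)"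
    and "\<And>i. i \<in> I \<Longrightarrow> orthonormal_basis (K i) (J i) (e i)"
    and "\<And>i j. i \<in> I \<Longrightarrow> j \<in> J i \<Longrightarrow> u i j = adj H (K i) (\<Lambda> i) (e i j)"
  shows "controlled_g_frame H I K T U \<Lambda> \<longleftrightarrow>
         controlled_frame H I J (adj H H U \<circ> op_inv H (adj H H T)) (\<lambda>i j. adj H H T (u i j))"
proof -
  note H = assms(1) and T = assms(3) and U = assms(4) and \<Lambda> = assms(5)
  interpret H: separable_hilbert_space H by fact
  note HC = H.complex_inner_space_axioms
  have KC: "complex_inner_space (K i)" if "i \<in> I" for i
    using assms(2)[OF that] by (simp add: separable_hilbert_space_def)
  note Tb = GL_bounded[OF T] and Ub = GL_bounded[OF U]
  let ?\<Omega> = "adj H H U \<circ> op_inv H (adj H H T)"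
  let ?\<phi> = "\<lambda>i j. adj H H T (u i j)"
  let ?Q = "\<lambda>f i. ip (K i) (\<Lambda> i (T f)) (\<Lambda> i (U f))"
  have \<Omega>: "?\<Omega> \<in> GL H"
    using H HC T U by (intro GL_comp GL_op_inv GL_adj)
  have e: "e i j \<in> carrier (K i)" if "i \<in> I" "j \<in> J i" for i j
    using assms(6)[OF that(1)] that(2) by (auto simp: orthonormal_basis_def)
  have u: "u i j \<in> carrier H" if "i \<in> I" "j \<in> J i" for i j
    using that assms(7) adj_closed[OF H KC \<Lambda>] e by simp
  have \<phi>: "\<forall>i\<in>I. \<forall>j\<in>J i. ?\<phi> i j \<in> carrier H"
    using u adj_closed[OF H HC Tb] by blast
  have inner: "((\<lambda>j. ip H f (?\<phi> i j) * ip H (?\<Omega> (?\<phi> i j)) f) has_sum ?Q f i) (J i)"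
    if i: "i \<in> I" and f: "f \<in> carrier H" for i f
  proof -
    interpret K: complex_inner_space "K i" using i by (rule KC)
    have Tf: "T f \<in> carrier H" and Uf: "U f \<in> carrier H"
      using bounded_ops_closed[OF Tb f] bounded_ops_closed[OF Ub f] by blast+
    have "ip (K i) (\<Lambda> i (T f)) (e i j) * ip (K i) (e i j) (\<Lambda> i (U f))
        = ip H f (?\<phi> i j) * ip H (?\<Omega> (?\<phi> i j)) f" if j: "j \<in> J i" for j
    proof (rule arg_cong2[where f = "(*)"])
      have "ip H f (?\<phi> i j) = ip H (T f) (u i j)"
        by (rule ip_adj_right[OF H HC Tb f u[OF i j]])
      also have "\<dots> = ip (K i) (\<Lambda> i (T f)) (e i j)"
        unfolding assms(7)[OF i j] by (rule ip_adj_right[OF H KC[OF i] \<Lambda>[OF i] Tf e[OF i j]])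
      finally show "ip (K i) (\<Lambda> i (T f)) (e i j) = ip H f (?\<phi> i j)" by (rule sym)
      have "?\<Omega> (?\<phi> i j) = adj H H U (u i j)"
        unfolding o_apply GL_left_inv[OF GL_adj[OF H T] u[OF i j]] by (rule refl)
      then have "ip H (?\<Omega> (?\<phi> i j)) f = ip H (adj H H U (u i j)) f"
        by (rule arg_cong[where f = "\<lambda>x. ip H x f"])
      also have "\<dots> = ip H (u i j) (U f)"
        by (rule ip_adj_left[OF H HC Ub f u[OF i j]])
      also have "\<dots> = ip (K i) (e i j) (\<Lambda> i (U f))"
        unfolding assms(7)[OF i j] by (rule ip_adj_left[OF H KC[OF i] \<Lambda>[OF i] Uf e[OF i j]])
      finally show "ip (K i) (e i j) (\<Lambda> i (U f)) = ip H (?\<Omega> (?\<phi> i j)) f" by (rule sym)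
    qed
    from has_sum_cong[THEN iffD1, OF this K.parseval[OF assms(6)[OF i]
        bounded_ops_closed[OF \<Lambda>[OF i] Tf] bounded_ops_closed[OF \<Lambda>[OF i] Uf]]]
    show ?thesis .
  qed
  \<comment> \<open>The inner sums determine the family \<open>t\<close> on the index set, so it can be eliminated.\<close>
  have frame_iff: "controlled_frame H I J ?\<Omega> ?\<phi> \<longleftrightarrow>
      (\<exists>A B. 0 < A \<and> A \<le> B \<and> (\<forall>f\<in>carrier H. \<exists>s::real. (?Q f has_sum complex_of_real s) I \<and>
         A * (ip_norm H f)\<^sup>2 \<le> s \<and> s \<le> B * (ip_norm H f)\<^sup>2))"
  proof -
    have eliminate: "(\<exists>t. \<exists>s::real.
           (\<forall>i\<in>I. ((\<lambda>j. ip H f (?\<phi> i j) * ip H (?\<Omega> (?\<phi> i j)) f) has_sum t i) (J i)) \<and>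
           (t has_sum complex_of_real s) I \<and> P s) \<longleftrightarrow>
        (\<exists>s::real. (?Q f has_sum complex_of_real s) I \<and> P s)"
      if f: "f \<in> carrier H" for f P
    proof
      assume "\<exists>t. \<exists>s::real.
           (\<forall>i\<in>I. ((\<lambda>j. ip H f (?\<phi> i j) * ip H (?\<Omega> (?\<phi> i j)) f) has_sum t i) (J i)) \<and>
           (t has_sum complex_of_real s) I \<and> P s"
      then obtain t s where
        t: "\<And>i. i \<in> I \<Longrightarrow> ((\<lambda>j. ip H f (?\<phi> i j) * ip H (?\<Omega> (?\<phi> i j)) f) has_sum t i) (J i)"
        and s: "(t has_sum complex_of_real s) I" "P s" by blast
      have "t i = ?Q f i" if "i \<in> I" for i
        using has_sum_unique[OF t[OF that] inner[OF that f]] .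
      then have "(?Q f has_sum complex_of_real s) I"
        by (rule has_sum_cong[THEN iffD1, OF _ s(1)])
      with s(2) show "\<exists>s::real. (?Q f has_sum complex_of_real s) I \<and> P s" by blast
    next
      assume "\<exists>s::real. (?Q f has_sum complex_of_real s) I \<and> P s"
      then obtain s where s: "(?Q f has_sum complex_of_real s) I" "P s" by (elim exE conjE)
      show "\<exists>t. \<exists>s::real.
           (\<forall>i\<in>I. ((\<lambda>j. ip H f (?\<phi> i j) * ip H (?\<Omega> (?\<phi> i j)) f) has_sum t i) (J i)) \<and>
           (t has_sum complex_of_real s) I \<and> P s"
        by (rule exI[of _ "?Q f"], rule exI[of _ s], intro conjI ballI inner f s)
    qed
    show ?thesis
      unfolding controlled_frame_def eqTrueI[OF \<Omega>] eqTrueI[OF \<phi>]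
      by (simp only: eliminate simp_thms cong: ball_cong)
  qed
  have bessel: "g_bessel H I K \<Lambda>" if frame: "controlled_frame H I J ?\<Omega> ?\<phi>"
  proof -
    obtain A B where AB: "0 < A" "A \<le> B"
      and "\<forall>f\<in>carrier H. \<exists>s::real. (?Q f has_sum complex_of_real s) I \<and>
         A * (ip_norm H f)\<^sup>2 \<le> s \<and> s \<le> B * (ip_norm H f)\<^sup>2"
      using frame unfolding frame_iff by (elim exE conjE)
    from bchoice[OF this(3)] obtain s
      where s: "\<And>f. f \<in> carrier H \<Longrightarrow> (?Q f has_sum complex_of_real (s f)) I \<and>
         A * (ip_norm H f)\<^sup>2 \<le> s f \<and> s f \<le> B * (ip_norm H f)\<^sup>2"
      by blast
    show ?thesis
    proof (rule g_bessel_if_upper_bound[OF HC KC T U \<Lambda>])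
      fix f assume f: "f \<in> carrier H"
      show "(?Q f has_sum complex_of_real (s f)) I" "s f \<le> B * (ip_norm H f)\<^sup>2"
        by (rule s[OF f, THEN conjunct1], rule s[OF f, THEN conjunct2, THEN conjunct2])
      have "0 \<le> A * (ip_norm H f)\<^sup>2" using AB by simp
      also have "\<dots> \<le> s f" by (rule s[OF f, THEN conjunct2, THEN conjunct1])
      finally show "0 \<le> s f" .
    qed (use AB in auto)
  qed
  have absorb: "G \<and> C \<longleftrightarrow> C" if "C \<Longrightarrow> G" for G C
    using that by blast
  show ?thesis
    using bessel
    unfolding controlled_g_frame_def frame_iff eqTrueI[OF T] eqTrueI[OF U] simp_thms by (rule absorb)
qed

end
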